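(* For all integers $b\geq0$ and $k\geq1$, \begin{align*} T_k(q^b,q) &= \sum_{i=0}^{k-1} \frac{q^{i(2k+1)}}{(q;q)_b} \genfrac{[}{]}{0pt}{}{b}{i}_{q^2} \sum_{j=-(k-i)}^{k-i} (-q)^{j^2} +\sum_{i=0}^{b-1}\frac{(q;q)_i}{(q;q)_b}\, q^{k(2k+2i+1)} \genfrac{[}{]}{0pt}{}{b-i-1}{k-1}_{q^2}, \\ T_k(-q^b,q) &= \sum_{i=0}^{k-1} \frac{q^{i(2k+1)}}{(-q;q)_b} \genfrac{[}{]}{0pt}{}{b}{i}_{q^2} +\sum_{i=0}^{b-1}\frac{(-q;q)_i}{(-q;q)_b}\, q^{k(2k+2i+1)} \genfrac{[}{]}{0pt}{}{b-i-1}{k-1}_{q^2}, \end{align*} and for all integers $b\geq1$ and $k\geq0$, \begin{align*} T_k(q^{-b},q) &= \sum_{i=0}^{b-1} (q^{1-b};q)_i\, (-q)^{k(k-2b+2)+2i} \genfrac{[}{]}{0pt}{}{k+i-1}{i}_{q^2}, \\ T_k(-q^{-b},q) &= \sum_{i=0}^{k-1} (-q^{1-b};q)_b\, (-q)^{i(2k-2b-i+2)} \genfrac{[}{]}{0pt}{}{b+i-1}{i}_{q^2} \\ &\quad +(-q)^{k^2+2k-2kb} \sum_{i=0}^{b-1} (-q^{1-b};q)_i\, q^{2i} \genfrac{[}{]}{0pt}{}{k+i-1}{i}_{q^2}. \end{align*}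
   Context: The polynomials $T_k(t,q)$ in the indeterminates $t,q$ are defined by $T_0(t,q)=1$ and, for $k\ge1$, \[ T_k(t,q) = T_{k-1}(t,q) + (1+t)(-q)^{k^2} + (1-t^2) \sum_{i=1}^{k-1} (-q)^{k^2-i^2}\, T_{i-1}(t,q). \] The identities are between rational functions in $q$, obtained by substituting $t=\pm q^{\pm b}$. Notation: $(a;q)_n=\prod_{l=0}^{n-1}(1-aq^l)$ for $n\ge0$; for $0\le m\le n$, $\genfrac{[}{]}{0pt}{}{n}{m}_{q}=\frac{(q;q)_n}{(q;q)_m(q;q)_{n-m}}$, and the subscript $q^2$ means $q$ is replaced by $q^2$. Conventions: $\genfrac{[}{]}{0pt}{}{n}{m}_{q}=0$ if $m<0$ or if $m>n$ and $m\ge 1$; $\genfrac{[}{]}{0pt}{}{n}{0}_q=1$ for all $n\ge -1$. Empty sums are $0$. *)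

theory Defs
  imports "HOL-Computational_Algebra.Computational_Algebra"
begin

text \<open>
  \<open>T_poly k\<close> is the polynomial $T_k(t,q)$ as an element of $(\mathbb{Z}[q])[t]$: the outer
  polynomial variable is $t$, the coefficients are polynomials in $q$.
\<close>

definition t_var :: "int poly poly" where
  "t_var = [:0, 1:]"

definition q_var :: "int poly poly" where
  "q_var = [:[:0, 1:]:]"

fun T_poly :: "nat \<Rightarrow> int poly poly" where
  "T_poly 0 = 1"
| "T_poly (Suc n) =
     T_poly n + (1 + t_var) * (- q_var) ^ ((Suc n)\<^sup>2)
     + (1 - t_var\<^sup>2) * (\<Sum>i = 1..n. (- q_var) ^ ((Suc n)\<^sup>2 - i\<^sup>2) * T_poly (i - 1))"

text \<open>
  \<open>ratfun\<close> is the field of fractions of $\mathbb{Z}[q]$, that is $\mathbb{Q}(q)$, and \<open>qq\<close>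
  is the indeterminate $q$ in it. \<open>T_at k x\<close> is the rational function $T_k(x,q)$.
\<close>

type_synonym ratfun = "int poly fract"

definition qq :: ratfun where
  "qq = to_fract [:0, 1:]"

definition T_at :: "nat \<Rightarrow> ratfun \<Rightarrow> ratfun" where
  "T_at k x = poly (map_poly to_fract (T_poly k)) x"

definition qpoch :: "'a::comm_ring_1 \<Rightarrow> 'a \<Rightarrow> nat \<Rightarrow> 'a" where
  "qpoch a x n = (\<Prod>l<n. 1 - a * x ^ l)"

text \<open>
  \<open>qbinom x n m\<close> is the Gaussian binomial coefficient with base \<open>x\<close>. The first branch includes
  the convention that its value is 1 at $n = -1$, $m = 0$; for $n < -1$, $m = 0$, where the
  symbol has no meaning, the value is 1 as well.
\<close>

definition qbinom :: "'a::field \<Rightarrow> int \<Rightarrow> int \<Rightarrow> 'a" where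
  "qbinom x n m =
     (if m = 0 then 1
      else if m < 0 \<or> m > n then 0
      else qpoch x x (nat n) / (qpoch x x (nat m) * qpoch x x (nat (n - m))))"

end

theory Submission
  imports Defs
begin

text \<open>
  Subtracting consecutive instances of the defining recurrence gives
  $T_{k+2} = (1-q^{2k+3})\,T_{k+1} + t^2 q^{2k+3}\,T_k$, and this implies the contiguity relation
  $(1-tq)\,T_{k+1}(tq,q) = T_{k+1}(t,q) + t^2q^{2k+3}\,T_k(t,q)$. By the $q$-Pascal rules, the right-hand
  sides of all four identities satisfy the corresponding relation in $b$. For positive powers of $q$
  induction on $b$ starts from $T_k(1,q) = \sum_{|j|\le k}(-q)^{j^2}$ and $T_k(-1,q) = 1$.
  For negative powers the relation is read as a recurrence in $k$ for $t = \pm q^{-b-1}$ with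
  inhomogeneity given by $t = \pm q^{-b}$; for the plus sign the inhomogeneity vanishes at $b = 0$.
\<close>

section \<open>q-Pochhammer symbols and the q-Pascal rules\<close>

lemma qpoch_0 [simp]: "qpoch a x 0 = 1"
  by (simp add: qpoch_def)

lemma qpoch_Suc: "qpoch a x (Suc n) = qpoch a x n * (1 - a * x ^ n)"
  by (simp add: qpoch_def)

lemma qpoch_Suc_shift: "qpoch a x (Suc n) = (1 - a) * qpoch (a * x) x n"
  unfolding qpoch_def by (subst prod.lessThan_Suc_shift) (simp add: mult.assoc)

lemma qbinom_0_right [simp]: "qbinom x n 0 = 1"
  by (simp add: qbinom_def)

lemma qbinom_eq_0: "n < m \<Longrightarrow> m \<noteq> 0 \<Longrightarrow> qbinom x n m = 0"
  by (simp add: qbinom_def)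

lemma qpoch_self_nonzero:
  fixes x :: "'a::field"
  assumes "\<And>n. 0 < n \<Longrightarrow> x ^ n \<noteq> 1"
  shows "qpoch x x n \<noteq> 0"
proof -
  have "1 - x * x ^ l \<noteq> 0" for l
    using assms[of "Suc l"] by auto
  then show ?thesis by (simp add: qpoch_def)
qed

text \<open>Writing the upper index as m + d removes the case split and the conversions
  \<open>nat\<close> from \<open>qbinom\<close>. At m = 0 the quotient equals 1 because the
  remaining Pochhammer symbol is nonzero.\<close>

lemma qbinom_add:
  assumes "\<And>n. 0 < n \<Longrightarrow> x ^ n \<noteq> 1"
  shows "qbinom x (int (m + d)) (int m) = qpoch x x (m + d) / (qpoch x x m * qpoch x x d)"
proof -
  have "nat (int (m + d)) = m + d" "nat (int (m + d) - int m) = d"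
    by auto
  then show ?thesis
    using qpoch_self_nonzero[OF assms, of d]
    by (cases "m = 0") (simp_all add: qbinom_def)
qed

text \<open>The truncated exponent \<open>n - m\<close> is harmless: it is wrong only for n < m,
  where its cofactor is zero.\<close>

lemma qbinom_Suc_Suc:
  assumes x: "\<And>n. 0 < n \<Longrightarrow> x ^ n \<noteq> 1"
  shows "qbinom x (int (Suc n)) (int (Suc m))
    = qbinom x (int n) (int (Suc m)) + x ^ (n - m) * qbinom x (int n) (int m)"
    and "qbinom x (int (Suc n)) (int (Suc m))
    = x ^ Suc m * qbinom x (int n) (int (Suc m)) + qbinom x (int n) (int m)"
proof -
  have "qbinom x (int (Suc n)) (int (Suc m))
      = qbinom x (int n) (int (Suc m)) + x ^ (n - m) * qbinom x (int n) (int m)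
    \<and> qbinom x (int (Suc n)) (int (Suc m))
      = x ^ Suc m * qbinom x (int n) (int (Suc m)) + qbinom x (int n) (int m)"
  proof (cases n m rule: linorder_cases)
    case less
    then show ?thesis by (simp add: qbinom_eq_0)
  next
    case equal
    then show ?thesis
      using qbinom_add[OF x, of m 0] qbinom_add[OF x, of "Suc m" 0] qpoch_self_nonzero[OF x]
      by (simp add: qbinom_eq_0)
  next
    case greater
    then obtain d where n: "n = Suc m + d"
      using less_imp_Suc_add by auto
    define M D N where "M = qpoch x x m" and "D = qpoch x x d" and "N = qpoch x x n"
    have nz: "M \<noteq> 0" "D \<noteq> 0" "1 - x * x ^ m \<noteq> 0" "1 - x * x ^ d \<noteq> 0"
      using qpoch_self_nonzero[OF x] x[of "Suc m"] x[of "Suc d"] by (auto simp: M_def D_def)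
    have "qbinom x (int (Suc n)) (int (Suc m))
        = N * (1 - x * x ^ n) / (M * (1 - x * x ^ m) * (D * (1 - x * x ^ d)))"
      using qbinom_add[OF x, of "Suc m" "Suc d"] n
      by (simp add: qpoch_Suc M_def D_def N_def)
    moreover have "qbinom x (int n) (int (Suc m)) = N / (M * (1 - x * x ^ m) * D)"
      using qbinom_add[OF x, of "Suc m" d] n
      by (simp add: qpoch_Suc M_def D_def N_def)
    moreover have "qbinom x (int n) (int m) = N / (M * (D * (1 - x * x ^ d)))"
      using qbinom_add[OF x, of m "Suc d"] n
      by (simp add: qpoch_Suc M_def D_def N_def)
    moreover have "n - m = Suc d" "x ^ n = x * x ^ m * x ^ d"
      using n by (simp_all add: power_add)
    \<comment> \<open>Over a common denominator the two rules become 1 - x^(n+1) = (1 - x^(d+1)) +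
      x^(d+1) (1 - x^(m+1)) and the same equation with m and d exchanged, where n = m + 1 +
      d.\<close>
    ultimately show ?thesis
      using nz by (simp only: power_Suc) (simp add: divide_simps, simp add: algebra_simps)
  qed
  then show "qbinom x (int (Suc n)) (int (Suc m))
      = qbinom x (int n) (int (Suc m)) + x ^ (n - m) * qbinom x (int n) (int m)"
    and "qbinom x (int (Suc n)) (int (Suc m))
      = x ^ Suc m * qbinom x (int n) (int (Suc m)) + qbinom x (int n) (int m)"
    by blast+
qed

section \<open>Values of T_k in the rational functions: recurrence, contiguity, t = 1 and t =
  -1\<close>

lemma qq_power_neq_1: "0 < n \<Longrightarrow> qq ^ n \<noteq> 1"
proof
  assume n: "0 < n" and "qq ^ n = 1"
  have "to_fract (p ^ m) = to_fract p ^ m" for p :: "int poly" and m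
    by (induction m) simp_all
  with \<open>qq ^ n = 1\<close> have "to_fract ([:0, 1:] ^ n :: int poly) = to_fract 1"
    by (simp add: qq_def)
  then have "([:0, 1:] ^ n :: int poly) = 1"
    by (simp only: to_fract_eq_iff)
  then have "degree ([:0, 1:] ^ n :: int poly) = 0"
    by simp
  then show False using n by (simp add: degree_power_eq)
qed

lemma qq_nonzero [simp]: "qq \<noteq> 0"
  by (simp add: qq_def)

lemma T_at_0 [simp]: "T_at 0 x = 1"
  by (simp add: T_at_def)

text \<open>Embedding the coefficients and then evaluating at \<open>x\<close> is a ring
  homomorphism (\<open>h\<close> in the proof), so it carries over the defining recurrence of
  \<open>T_poly\<close>.\<close>

lemma T_at_Suc:
  "T_at (Suc n) x = T_at n x + (1 + x) * (- qq) ^ ((Suc n)\<^sup>2)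
     + (1 - x\<^sup>2) * (\<Sum>i = 1..n. (- qq) ^ ((Suc n)\<^sup>2 - i\<^sup>2) * T_at (i - 1) x)"
proof -
  define h where "h p = poly (map_poly to_fract p) x" for p :: "int poly poly"
  have add: "h (p + r) = h p + h r" for p r
    by (simp add: h_def)
  have mult: "h (p * r) = h p * h r" for p r
    by (simp add: h_def)
  have one: "h 1 = 1" by (simp add: h_def)
  have diff: "h (p - r) = h p - h r" for p r
    by (simp add: h_def)
  have power: "h (p ^ m) = h p ^ m" for p m
    by (induction m) (simp_all add: one mult)
  have sum: "h (sum f A) = (\<Sum>i\<in>A. h (f i))" if "finite A" for f and A :: "nat set"
    using that by (induction A rule: finite_induct) (simp_all add: add, simp add: h_def)
  have "h t_var = x" "h q_var = qq"
    by (simp_all add: h_def t_var_def q_var_def qq_def map_poly_pCons)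
  moreover have "h (- p) = - h p" for p
    using diff[of 0 p] by (simp add: h_def)
  ultimately have "h (T_poly (Suc n)) = h (T_poly n) + (1 + x) * (- qq) ^ ((Suc n)\<^sup>2)
     + (1 - x\<^sup>2) * (\<Sum>i = 1..n. (- qq) ^ ((Suc n)\<^sup>2 - i\<^sup>2) * h (T_poly (i - 1)))"
    by (simp add: add mult one diff power sum)
  then show ?thesis
    by (simp only: h_def T_at_def)
qed

lemma T_at_1: "T_at (Suc 0) x = 1 - (1 + x) * qq"
  by (simp add: T_at_Suc)

lemma T_at_rec:
  "T_at (Suc (Suc k)) x
    = (1 - qq ^ (2 * k + 3)) * T_at (Suc k) x + x\<^sup>2 * qq ^ (2 * k + 3) * T_at k x"
proof -
  define S where "S n = (\<Sum>i = 1..n. (- qq) ^ ((Suc n)\<^sup>2 - i\<^sup>2) * T_at (i - 1) x)" for n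
  have sq: "(Suc (Suc k))\<^sup>2 = 2 * k + 3 + (Suc k)\<^sup>2"
    by (simp add: power2_eq_square)
  have sgn: "(- qq) ^ (2 * k + 3) = - (qq ^ (2 * k + 3))"
    by (rule power_minus_odd) simp
  have S: "S (Suc k) = (- qq) ^ (2 * k + 3) * (S k + T_at k x)"
  proof -
    have "(\<Sum>i = 1..k. (- qq) ^ ((Suc (Suc k))\<^sup>2 - i\<^sup>2) * T_at (i - 1) x)
        = (\<Sum>i = 1..k. (- qq) ^ (2 * k + 3) * ((- qq) ^ ((Suc k)\<^sup>2 - i\<^sup>2) * T_at (i - 1) x))"
    proof (rule sum.cong[OF refl])
      fix i assume "i \<in> {1..k}"
      \<comment> \<open>This bound makes the natural-number difference of squares exact.\<close>
      then have "i\<^sup>2 \<le> (Suc k)\<^sup>2"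
        by (intro power_mono) auto
      then have "(Suc (Suc k))\<^sup>2 - i\<^sup>2 = 2 * k + 3 + ((Suc k)\<^sup>2 - i\<^sup>2)"
        by (simp only: sq)
      then show "(- qq) ^ ((Suc (Suc k))\<^sup>2 - i\<^sup>2) * T_at (i - 1) x
          = (- qq) ^ (2 * k + 3) * ((- qq) ^ ((Suc k)\<^sup>2 - i\<^sup>2) * T_at (i - 1) x)"
        by (simp only: power_add mult.assoc)
    qed
    moreover have "(Suc (Suc k))\<^sup>2 - (Suc k)\<^sup>2 = 2 * k + 3"
      by (simp only: sq)
    ultimately show ?thesis
      by (simp add: S_def sum_distrib_left distrib_left)
  qed
  have T: "T_at (Suc n) x = T_at n x + (1 + x) * (- qq) ^ ((Suc n)\<^sup>2) + (1 - x\<^sup>2) * S n" for n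
    unfolding S_def by (rule T_at_Suc)
  \<comment> \<open>By the instance at k, T_(k+1) - T_k is the power term plus (1 - x^2)
    \<open>S k\<close>. Thus the bracket eliminates \<open>S k\<close>; its last summand is the term
    that \<open>S (Suc k)\<close> gains.\<close>
  have "T_at (Suc (Suc k)) x
      = T_at (Suc k) x + (- qq) ^ (2 * k + 3) * (T_at (Suc k) x - T_at k x + (1 - x\<^sup>2) * T_at k x)"
    unfolding T[of "Suc k"] S sq power_add[of _ "2 * k + 3"] by (subst T[of k])+ (simp add: algebra_simps)
  then show ?thesis
    unfolding sgn by (simp add: algebra_simps)
qed

text \<open>Every induction on b rests on this relation. The three-term recurrence at
  \<open>x * qq\<close> expresses the left side through its two predecessors, hence strong induction
  with two base cases.\<close>

lemma T_at_mult_qq: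
  "(1 - x * qq) * T_at (Suc k) (x * qq) = T_at (Suc k) x + x\<^sup>2 * qq ^ (2 * k + 3) * T_at k x"
proof (induction k rule: less_induct)
  case (less k)
  consider "k = 0" | "k = 1" | l where "k = Suc (Suc l)"
    by (metis One_nat_def not0_implies_Suc)
  then show ?case
  proof cases
    case 1
    then show ?thesis
      by (simp add: T_at_1 algebra_simps power2_eq_square numeral_eq_Suc)
  next
    case 2
    have rec: "T_at (Suc (Suc 0)) y = (1 - qq ^ 3) * (1 - (1 + y) * qq) + y\<^sup>2 * qq ^ 3" for y
      using T_at_rec[of 0 y] by (simp add: T_at_1)
    show ?thesis
      unfolding 2 One_nat_def rec T_at_1 by (simp add: algebra_simps eval_nat_numeral)
  next
    case 3
    define w where "w = qq ^ (2 * l + 3)"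
    have w: "qq ^ (2 * l + 5) = qq\<^sup>2 * w" "qq ^ (2 * l + 7) = qq ^ 4 * w"
      by (simp_all add: w_def power_add)
    define c where "c = 1 - x * qq"
    have l: "c * T_at (Suc l) (x * qq) = T_at (Suc l) x + x\<^sup>2 * w * T_at l x"
      using less[of l] 3 by (simp add: w_def c_def)
    have Sl: "c * T_at (Suc (Suc l)) (x * qq)
        = T_at (Suc (Suc l)) x + x\<^sup>2 * (qq\<^sup>2 * w) * T_at (Suc l) x"
      using less[of "Suc l"] 3 w by (simp add: c_def eval_nat_numeral)
    have rec: "T_at (Suc (Suc (Suc l))) y
        = (1 - qq\<^sup>2 * w) * T_at (Suc (Suc l)) y + y\<^sup>2 * (qq\<^sup>2 * w) * T_at (Suc l) y" for y
      using T_at_rec[of "Suc l" y] w by (simp add: eval_nat_numeral)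
    have rec': "T_at (Suc (Suc l)) x = (1 - w) * T_at (Suc l) x + x\<^sup>2 * w * T_at l x"
      using T_at_rec[of l x] by (simp add: w_def)
    have "c * T_at (Suc (Suc (Suc l))) (x * qq)
        = (1 - qq\<^sup>2 * w) * (c * T_at (Suc (Suc l)) (x * qq))
          + x\<^sup>2 * qq ^ 4 * w * (c * T_at (Suc l) (x * qq))"
      unfolding rec by (simp add: algebra_simps eval_nat_numeral)
    also have "\<dots> = T_at (Suc (Suc (Suc l))) x + x\<^sup>2 * (qq ^ 4 * w) * T_at (Suc (Suc l)) x"
      \<comment> \<open>Both sides are reduced to T_(l+1) and T_l at \<open>x\<close>, with
        coefficients that are polynomials in q, x and \<open>w\<close>.\<close>
      unfolding l Sl rec unfolding rec' by (simp add: algebra_simps eval_nat_numeral)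
    finally show ?thesis
      using 3 w by (simp add: c_def eval_nat_numeral)
  qed
qed

text \<open>At x = 1 the factor 1 - x^2 removes the sum, and 1 + x = 2 counts the two new indices j
  = k+1 and j = -(k+1).\<close>

lemma T_at_one: "T_at k 1 = (\<Sum>j = - int k..int k. (- qq) powi (j\<^sup>2))"
proof (induction k)
  case 0
  then show ?case by simp
next
  case (Suc k)
  have "{- int (Suc k)..int (Suc k)} = insert (int (Suc k)) (insert (- int (Suc k)) {- int k..int k})"
    by auto
  moreover have "(- qq) powi ((int (Suc k))\<^sup>2) = (- qq) ^ ((Suc k)\<^sup>2)"
    by (metis of_nat_power power_int_of_nat)
  moreover from this have "(- qq) powi ((- int (Suc k))\<^sup>2) = (- qq) ^ ((Suc k)\<^sup>2)"
    by (simp only: power2_minus)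
  ultimately show ?case
    using Suc by (simp add: T_at_Suc[of k])
qed

lemma T_at_minus_one: "T_at k (- 1) = 1"
  by (induction k) (simp_all add: T_at_Suc)

section \<open>Nonnegative powers: t = \<epsilon> q^b with \<epsilon>^2 = 1\<close>

lemma qq_square_power_neq_1: "0 < n \<Longrightarrow> (qq\<^sup>2) ^ n \<noteq> 1"
  using qq_power_neq_1[of "2 * n"] by (simp add: power_mult)

lemma qbinom_qq_square_Suc_Suc:
  "qbinom (qq\<^sup>2) (int (Suc n)) (int (Suc m))
    = qbinom (qq\<^sup>2) (int n) (int (Suc m)) + (qq\<^sup>2) ^ (n - m) * qbinom (qq\<^sup>2) (int n) (int m)"
  "qbinom (qq\<^sup>2) (int (Suc n)) (int (Suc m))
    = (qq\<^sup>2) ^ Suc m * qbinom (qq\<^sup>2) (int n) (int (Suc m)) + qbinom (qq\<^sup>2) (int n) (int m)"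
  by (rule qbinom_Suc_Suc; rule qq_square_power_neq_1; assumption)+

text \<open>This and \<open>tail_sum\<close> are the two sums of the first two identities with the
  denominator (\<epsilon>q;q)_b cleared. Both signs are covered by taking T_n(\<epsilon>) for
  \<open>\<theta> n\<close> and (\<epsilon>q;q)_i for \<open>P i\<close>.\<close>

definition lead_sum :: "(nat \<Rightarrow> ratfun) \<Rightarrow> nat \<Rightarrow> nat \<Rightarrow> ratfun" where
  "lead_sum \<theta> b k
    = (\<Sum>i<k. qq ^ (i * (2 * k + 1)) * qbinom (qq\<^sup>2) (int b) (int i) * \<theta> (k - i))"

definition tail_sum :: "(nat \<Rightarrow> ratfun) \<Rightarrow> nat \<Rightarrow> nat \<Rightarrow> ratfun" where
  "tail_sum P b k
    = (\<Sum>i<b. P i * qq ^ (k * (2 * k + 2 * i + 1)) * qbinom (qq\<^sup>2) (int b - int i - 1) (int k - 1))"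

text \<open>The first q-Pascal rule splits the term i = j+1. Its weight q^(2(b-j)) fits because
  (j+1)(2k+3) + 2(b-j) = (2b+2k+3) + j(2k+1); the term i = 0 does not depend on b.\<close>

lemma lead_sum_Suc:
  "lead_sum \<theta> (Suc b) (Suc k) = lead_sum \<theta> b (Suc k) + qq ^ (2 * b + 2 * k + 3) * lead_sum \<theta> b k"
proof -
  have "qq ^ (Suc j * (2 * Suc k + 1)) * qbinom (qq\<^sup>2) (int (Suc b)) (int (Suc j)) * \<theta> (Suc k - Suc j)
      = qq ^ (Suc j * (2 * Suc k + 1)) * qbinom (qq\<^sup>2) (int b) (int (Suc j)) * \<theta> (Suc k - Suc j)
        + qq ^ (2 * b + 2 * k + 3) * (qq ^ (j * (2 * k + 1)) * qbinom (qq\<^sup>2) (int b) (int j) * \<theta> (k - j))"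
    for j
  proof -
    have "qq ^ (Suc j * (2 * Suc k + 1)) * (qq\<^sup>2) ^ (b - j) * qbinom (qq\<^sup>2) (int b) (int j)
        = qq ^ (2 * b + 2 * k + 3) * qq ^ (j * (2 * k + 1)) * qbinom (qq\<^sup>2) (int b) (int j)"
    \<comment> \<open>For j > b the truncated exponent is wrong, but the binomial coefficient
      vanishes.\<close>
    proof (cases "j \<le> b")
      case True
      then obtain d where "b = j + d"
        using le_Suc_ex by blast
      then have "Suc j * (2 * Suc k + 1) + 2 * (b - j) = 2 * b + 2 * k + 3 + j * (2 * k + 1)"
        by (simp add: algebra_simps)
      then show ?thesis
        by (simp only: flip: power_add power_mult)
    qed (simp add: qbinom_eq_0)
    then show ?thesis
      unfolding qbinom_qq_square_Suc_Suc(1) diff_Suc_Suc by (simp only: distrib_left distrib_right mult_ac)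
  qed
  then show ?thesis
    unfolding lead_sum_def sum.lessThan_Suc_shift[of _ k]
    by (simp only: sum.distrib sum_distrib_left) (simp add: add.assoc)
qed

text \<open>For k > 0 this is again q-Pascal, and the new term i = b vanishes. For k = 0 all
  binomials on the left are 1, so only the new term \<open>P b\<close> is added, whereas
  \<open>tail_sum P b 0\<close> is zero because its lower index is -1.\<close>

lemma tail_sum_Suc:
  "tail_sum P (Suc b) (Suc k)
    = tail_sum P b (Suc k) + qq ^ (2 * b + 2 * k + 3) * (if k = 0 then P b else tail_sum P b k)"
proof (cases k)
  case 0
  then show ?thesis
    by (simp add: tail_sum_def power_add eval_nat_numeral)
next
  case (Suc l)
  have "P i * qq ^ (Suc k * (2 * Suc k + 2 * i + 1)) * qbinom (qq\<^sup>2) (int (Suc b) - int i - 1) (int (Suc k) - 1)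
      = P i * qq ^ (Suc k * (2 * Suc k + 2 * i + 1)) * qbinom (qq\<^sup>2) (int b - int i - 1) (int (Suc k) - 1)
        + qq ^ (2 * b + 2 * k + 3)
          * (P i * qq ^ (k * (2 * k + 2 * i + 1)) * qbinom (qq\<^sup>2) (int b - int i - 1) (int k - 1))"
    if "i < b" for i
  proof -
    obtain n where b: "b = Suc (i + n)"
      using \<open>i < b\<close> less_imp_Suc_add by auto
    have ints: "int (Suc b) - int i - 1 = int (Suc n)" "int b - int i - 1 = int n"
        "int (Suc k) - 1 = int (Suc l)" "int k - 1 = int l"
      using b Suc by auto
    have "qq ^ (Suc k * (2 * Suc k + 2 * i + 1)) * (qq\<^sup>2) ^ (n - l) * qbinom (qq\<^sup>2) (int n) (int l)
        = qq ^ (2 * b + 2 * k + 3) * qq ^ (k * (2 * k + 2 * i + 1)) * qbinom (qq\<^sup>2) (int n) (int l)"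
    proof (cases "l \<le> n")
      case True
      then obtain d where "n = l + d"
        using le_Suc_ex by blast
      then have "Suc k * (2 * Suc k + 2 * i + 1) + 2 * (n - l) = 2 * b + 2 * k + 3 + k * (2 * k + 2 * i + 1)"
        using b Suc by (simp add: algebra_simps)
      then show ?thesis
        by (simp only: flip: power_add power_mult)
    qed (simp add: qbinom_eq_0)
    then show ?thesis
      unfolding ints qbinom_qq_square_Suc_Suc(1) by (simp only: distrib_left distrib_right mult_ac)
  qed
  moreover have "qbinom (qq\<^sup>2) (int (Suc b) - int b - 1) (int (Suc k) - 1) = 0"
    using Suc by (intro qbinom_eq_0) auto
  ultimately show ?thesis
    unfolding tail_sum_def using Suc
    by (simp add: sum.distrib sum_distrib_left)
qed

lemma T_at_qq_power:
  assumes \<epsilon>: "\<epsilon>\<^sup>2 = 1"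
  shows "qpoch (\<epsilon> * qq) qq b * T_at (Suc k) (\<epsilon> * qq ^ b)
    = lead_sum (\<lambda>n. T_at n \<epsilon>) b (Suc k) + tail_sum (qpoch (\<epsilon> * qq) qq) b (Suc k)"
proof (induction b arbitrary: k)
  case 0
  have "lead_sum (\<lambda>n. T_at n \<epsilon>) 0 (Suc k) = T_at (Suc k) \<epsilon>"
    unfolding lead_sum_def by (subst sum.lessThan_Suc_shift) (simp add: qbinom_eq_0)
  then show ?case
    by (simp add: tail_sum_def)
next
  case (Suc b)
  let ?P = "qpoch (\<epsilon> * qq) qq"
  have P: "?P (Suc b) = ?P b * (1 - \<epsilon> * qq ^ b * qq)"
    by (simp add: qpoch_Suc mult_ac)
  have e: "(\<epsilon> * qq ^ b)\<^sup>2 * qq ^ (2 * k + 3) = qq ^ (2 * b + 2 * k + 3)"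
    using \<epsilon> by (simp add: power_mult_distrib mult.commute[of 2] add.assoc flip: power_mult power_add)
  \<comment> \<open>The induction hypothesis covers positive indices only. At k = 0, T_0 = 1 leaves
    \<open>?P b\<close>, exactly the exceptional term of \<open>tail_sum_Suc\<close>.\<close>
  have low: "?P b * T_at k (\<epsilon> * qq ^ b)
      = lead_sum (\<lambda>n. T_at n \<epsilon>) b k + (if k = 0 then ?P b else tail_sum ?P b k)"
    using Suc.IH[of "k - 1"] by (cases k) (simp_all add: lead_sum_def)
  have "?P (Suc b) * T_at (Suc k) (\<epsilon> * qq ^ Suc b)
      = ?P b * ((1 - \<epsilon> * qq ^ b * qq) * T_at (Suc k) (\<epsilon> * qq ^ b * qq))"
    by (simp only: P power_Suc2 mult.assoc)
  also have "\<dots> = ?P b * T_at (Suc k) (\<epsilon> * qq ^ b)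
      + qq ^ (2 * b + 2 * k + 3) * (?P b * T_at k (\<epsilon> * qq ^ b))"
    unfolding T_at_mult_qq e by (simp only: distrib_left mult_ac)
  finally show ?case
    unfolding Suc.IH low lead_sum_Suc tail_sum_Suc by (simp only: distrib_left ac_simps)
qed

section \<open>Negative powers: t = \<epsilon> q^(-b)\<close>

lemma T_at_qq_negative_step:
  assumes "\<epsilon>\<^sup>2 = 1"
  shows "(1 - \<epsilon> * qq powi (- int b)) * T_at (Suc k) (\<epsilon> * qq powi (- int b))
    = T_at (Suc k) (\<epsilon> * qq powi (- int (Suc b)))
      - (- qq) powi (2 * int k + 1 - 2 * int b) * T_at k (\<epsilon> * qq powi (- int (Suc b)))"
proof -
  \<comment> \<open>Contiguity is applied at this \<open>x\<close>, so that x q = \<epsilon> q^(-b)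
    and the relation becomes a recurrence in k at \<open>x\<close>.\<close>
  define x where "x = \<epsilon> * qq powi (- int (Suc b))"
  have x: "x * qq = \<epsilon> * qq powi (- int b)"
    by (simp add: x_def power_int_diff power_int_minus divide_simps)
  have "x\<^sup>2 * qq ^ (2 * k + 3) = qq powi (- 2 * int (Suc b)) * qq powi (int (2 * k + 3))"
  proof -
    have "(qq powi m)\<^sup>2 = qq powi (2 * m)" for m
      by (simp add: power2_eq_square flip: power_int_add mult_2)
    then show ?thesis
      using assms by (simp only: x_def power_mult_distrib power_int_of_nat) simp
  qed
  also have "\<dots> = qq powi (2 * int k + 1 - 2 * int b)"
    by (simp add: algebra_simps flip: power_int_add)
  \<comment> \<open>The exponent is odd; passing to powers of -q matches the closed forms.\<close>
  also have "\<dots> = - ((- qq) powi (2 * int k + 1 - 2 * int b))"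
    by (simp add: power_int_minus_left)
  finally have "x\<^sup>2 * qq ^ (2 * k + 3) = - ((- qq) powi (2 * int k + 1 - 2 * int b))" .
  then show ?thesis
    using T_at_mult_qq[of x k] unfolding x x_def[symmetric] by simp
qed

definition neg_sum :: "ratfun \<Rightarrow> nat \<Rightarrow> nat \<Rightarrow> ratfun" where
  "neg_sum \<epsilon> b k = (- qq) powi (int k * (int k - 2 * int b + 2))
    * (\<Sum>i<b. qpoch (\<epsilon> * qq powi (1 - int b)) qq i * qq ^ (2 * i) * qbinom (qq\<^sup>2) (int k + int i - 1) (int i))"

text \<open>For \<epsilon> = 1 and b \<ge> 1 this is zero, since (q^(1-b);q)_b contains the factor 1
  - q^0. This is why only the identity for -q^(-b) has such a sum.\<close>

definition neg_lead_sum :: "ratfun \<Rightarrow> nat \<Rightarrow> nat \<Rightarrow> ratfun" where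
  "neg_lead_sum \<epsilon> b k = qpoch (\<epsilon> * qq powi (1 - int b)) qq b
    * (\<Sum>i<k. (- qq) powi (int i * (2 * int k - 2 * int b - int i + 2)) * qbinom (qq\<^sup>2) (int b + int i - 1) (int i))"

lemma qpoch_negative_Suc:
  "qpoch (\<epsilon> * qq powi (1 - int (Suc b))) qq (Suc i)
    = (1 - \<epsilon> * qq powi (- int b)) * qpoch (\<epsilon> * qq powi (1 - int b)) qq i"
proof -
  have "\<epsilon> * qq powi (- int b) * qq = \<epsilon> * qq powi (1 - int b)"
    by (simp add: power_int_diff power_int_minus divide_simps)
  moreover have "1 - int (Suc b) = - int b"
    by simp
  ultimately show ?thesis
    by (simp only: qpoch_Suc_shift)
qed

text \<open>Only i = 0 survives, and there the convention for upper index -1 gives the value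
  1.\<close>

lemma neg_sum_0 [simp]: "neg_sum \<epsilon> (Suc b) 0 = 1"
proof -
  have "qbinom (qq\<^sup>2) (int 0 + int (Suc i) - 1) (int (Suc i)) = 0" for i
    by (rule qbinom_eq_0) auto
  then show ?thesis
    unfolding neg_sum_def by (subst sum.lessThan_Suc_shift) simp
qed

text \<open>After extraction of the common power \<open>C\<close>, the right side contains
  differences of binomials in k. The difference is 0 at i = 0, and q-Pascal with the shift i -> i+1
  gives the rest; \<open>qpoch_negative_Suc\<close> supplies the factor 1 - \<epsilon>
  q^(-b).\<close>

lemma neg_sum_Suc:
  "(1 - \<epsilon> * qq powi (- int b)) * neg_sum \<epsilon> b (Suc k)
    = neg_sum \<epsilon> (Suc b) (Suc k) - (- qq) powi (2 * int k + 1 - 2 * int b) * neg_sum \<epsilon> (Suc b) k"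
proof -
  define C where "C = (- qq) powi ((int k + 1) * (int k + 1 - 2 * int b))"
  define P where "P = qpoch (\<epsilon> * qq powi (1 - int (Suc b))) qq"
  define Q where "Q = qpoch (\<epsilon> * qq powi (1 - int b)) qq"
  have C: "(- qq) powi (int (Suc k) * (int (Suc k) - 2 * int (Suc b) + 2)) = C"
    unfolding C_def by (rule arg_cong[of _ _ "power_int _"]) (simp add: algebra_simps)
  have C': "(- qq) powi (2 * int k + 1 - 2 * int b) * (- qq) powi (int k * (int k - 2 * int (Suc b) + 2)) = C"
    unfolding C_def by (subst power_int_add[symmetric]) (auto intro!: arg_cong[of _ _ "power_int _"] simp: algebra_simps)
  \<comment> \<open>The extra q^(2k+2) is made up of q^(2k) from q-Pascal and q^2 from the index
    shift.\<close>
  have C'': "(- qq) powi (int (Suc k) * (int (Suc k) - 2 * int b + 2)) = C * qq ^ (2 * k + 2)"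
  proof -
    have "qq ^ (2 * k + 2) = (- qq) ^ (2 * k + 2)"
      by simp
    also have "\<dots> = (- qq) powi (int (2 * k + 2))"
      by (simp only: power_int_of_nat)
    finally show ?thesis
      unfolding C_def
      by (simp only: power_int_add[symmetric] neg_equal_0_iff_equal qq_nonzero simp_thms)
        (auto intro!: arg_cong[of _ _ "power_int _"] simp: algebra_simps)
  qed
  have "neg_sum \<epsilon> (Suc b) (Suc k) - (- qq) powi (2 * int k + 1 - 2 * int b) * neg_sum \<epsilon> (Suc b) k
      = C * (\<Sum>i<Suc b. P i * qq ^ (2 * i)
          * (qbinom (qq\<^sup>2) (int (Suc k) + int i - 1) (int i) - qbinom (qq\<^sup>2) (int k + int i - 1) (int i)))"
    unfolding neg_sum_def C mult.assoc[symmetric] C' P_def[symmetric]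
    by (simp only: right_diff_distrib sum_subtractf)
  also have "\<dots> = C * (\<Sum>i<b. P (Suc i) * qq ^ (2 * Suc i)
          * ((qq\<^sup>2) ^ k * qbinom (qq\<^sup>2) (int (Suc k) + int i - 1) (int i)))"
  proof -
    have "qbinom (qq\<^sup>2) (int (Suc k) + int (Suc i) - 1) (int (Suc i)) - qbinom (qq\<^sup>2) (int k + int (Suc i) - 1) (int (Suc i))
        = (qq\<^sup>2) ^ k * qbinom (qq\<^sup>2) (int (Suc k) + int i - 1) (int i)" for i
    proof -
      have "int (Suc k) + int (Suc i) - 1 = int (Suc (k + i))" "int k + int (Suc i) - 1 = int (k + i)"
          "int (Suc k) + int i - 1 = int (k + i)"
        by simp_all
      then show ?thesis
        using qbinom_qq_square_Suc_Suc(1)[of "k + i" i] by simp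
    qed
    then show ?thesis
      by (simp only: sum.lessThan_Suc_shift) simp
  qed
  also have "\<dots> = (1 - \<epsilon> * qq powi (- int b)) * (C * qq ^ (2 * k + 2)
      * (\<Sum>i<b. Q i * qq ^ (2 * i) * qbinom (qq\<^sup>2) (int (Suc k) + int i - 1) (int i)))"
    unfolding P_def Q_def qpoch_negative_Suc sum_distrib_left
    by (rule sum.cong) (simp_all add: power_add power_mult power_mult_distrib power2_eq_square mult_ac)
  finally show ?thesis
    unfolding neg_sum_def C'' Q_def by simp
qed

text \<open>Here the second q-Pascal rule is applied: its factor q^(2(i+1)) turns the powers
  \<open>E\<close> for b+1 into the powers \<open>D\<close> for b, and its other term is the sum for
  k shifted by one. The Pochhammer prefactor is \<open>P\<close> throughout.\<close>

lemma neg_lead_sum_Suc: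
  "(1 - \<epsilon> * qq powi (- int b)) * neg_lead_sum \<epsilon> b (Suc k)
    = neg_lead_sum \<epsilon> (Suc b) (Suc k) - (- qq) powi (2 * int k + 1 - 2 * int b) * neg_lead_sum \<epsilon> (Suc b) k"
proof -
  define E where "E i = (- qq) powi (int i * (2 * int k - 2 * int b - int i + 2))" for i
  define D where "D i = (- qq) powi (int i * (2 * int k - 2 * int b - int i + 4))" for i
  define B where "B n i = qbinom (qq\<^sup>2) (int n + int i - 1) (int i)" for n i
  define c where "c = (- qq) powi (2 * int k + 1 - 2 * int b)"
  define P where "P = qpoch (\<epsilon> * qq powi (1 - int (Suc b))) qq (Suc b)"
  have D: "D i = E i * (qq\<^sup>2) ^ i" for i
  proof -
    have "(qq\<^sup>2) ^ i = (- qq) powi (2 * int i)"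
      by (simp add: power_int_mult)
    then show ?thesis
      unfolding D_def E_def
      by (simp only: power_int_add[symmetric] neg_equal_0_iff_equal qq_nonzero simp_thms)
        (auto intro!: arg_cong[of _ _ "power_int _"] simp: algebra_simps)
  qed
  have E: "E (Suc i) = c * (- qq) powi (int i * (2 * int k - 2 * int (Suc b) - int i + 2))" for i
    unfolding E_def c_def
    by (simp only: power_int_add[symmetric] neg_equal_0_iff_equal qq_nonzero simp_thms)
      (auto intro!: arg_cong[of _ _ "power_int _"] simp: algebra_simps)
  have "B (Suc b) (Suc i) = (qq\<^sup>2) ^ Suc i * B b (Suc i) + B (Suc b) i" for i
  proof -
    have "int (Suc b) + int (Suc i) - 1 = int (Suc (b + i))" "int b + int (Suc i) - 1 = int (b + i)"
        "int (Suc b) + int i - 1 = int (b + i)"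
      by simp_all
    then show ?thesis
      unfolding B_def by (simp only: qbinom_qq_square_Suc_Suc(2))
  qed
  then have "E (Suc i) * B (Suc b) (Suc i) = D (Suc i) * B b (Suc i) + E (Suc i) * B (Suc b) i" for i
    by (simp only: D distrib_left mult.assoc)
  then have "(\<Sum>i<Suc k. E i * B (Suc b) i) = (\<Sum>i<Suc k. D i * B b i) + (\<Sum>i<k. E (Suc i) * B (Suc b) i)"
    unfolding sum.lessThan_Suc_shift by (simp add: sum.distrib D B_def add.assoc)
  also have "(\<Sum>i<k. E (Suc i) * B (Suc b) i)
      = c * (\<Sum>i<k. (- qq) powi (int i * (2 * int k - 2 * int (Suc b) - int i + 2)) * B (Suc b) i)"
    by (simp only: E sum_distrib_left mult.assoc)
  finally have "P * (\<Sum>i<Suc k. D i * B b i) = P * (\<Sum>i<Suc k. E i * B (Suc b) i)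
      - c * (P * (\<Sum>i<k. (- qq) powi (int i * (2 * int k - 2 * int (Suc b) - int i + 2)) * B (Suc b) i))"
    by (simp add: algebra_simps)
  moreover have "neg_lead_sum \<epsilon> (Suc b) (Suc k) = P * (\<Sum>i<Suc k. E i * B (Suc b) i)"
  proof -
    have "2 * int (Suc k) - 2 * int (Suc b) - i + 2 = 2 * int k - 2 * int b - i + 2" for i
      by simp
    then show ?thesis
      unfolding neg_lead_sum_def P_def E_def B_def by (simp only:)
  qed
  moreover have "(1 - \<epsilon> * qq powi (- int b)) * neg_lead_sum \<epsilon> b (Suc k) = P * (\<Sum>i<Suc k. D i * B b i)"
  proof -
    have "2 * int (Suc k) - 2 * int b - i + 2 = 2 * int k - 2 * int b - i + 4" for i
      by simp
    then show ?thesis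
      unfolding neg_lead_sum_def P_def D_def B_def qpoch_negative_Suc by (simp only: mult.assoc)
  qed
  moreover have "neg_lead_sum \<epsilon> (Suc b) k
      = P * (\<Sum>i<k. (- qq) powi (int i * (2 * int k - 2 * int (Suc b) - int i + 2)) * B (Suc b) i)"
    by (simp only: neg_lead_sum_def P_def B_def)
  ultimately show ?thesis
    by (simp only: c_def)
qed

text \<open>Both sides satisfy the same recurrence in k and equal 1 at k = 0. Exponent 0 is excluded
  because \<open>neg_sum\<close> is then an empty sum.\<close>

lemma T_at_qq_negative_power: "T_at k (qq powi (- int (Suc b))) = neg_sum 1 (Suc b) k"
proof (induction b arbitrary: k)
  case 0
  show ?case
  proof (induction k)
    case (Suc k)
    then show ?case
      \<comment> \<open>The coefficient 1 - q^0 is zero, so the value of T at t = 1 does not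
        enter.\<close>
      using T_at_qq_negative_step[of 1 0 k] neg_sum_Suc[of 1 0 k] by simp
  qed simp
next
  case (Suc b)
  note IH = Suc.IH
  show ?case
  proof (induction k)
    case (Suc k)
    then show ?case
      using T_at_qq_negative_step[of 1 "Suc b" k] neg_sum_Suc[of 1 "Suc b" k] IH[of "Suc k"]
      by (simp del: of_nat_Suc)
  qed simp
qed

text \<open>Now the coefficient 1 + q^(-b) does not vanish at b = 0, and the induction starts from
  T_k(-1) = 1. The index is \<open>Suc k\<close> because at b = k = 0 both sums are empty; for
  positive b the case k = 0 holds too, which \<open>low\<close> uses.\<close>

lemma T_at_minus_qq_negative_power:
  "T_at (Suc k) (- (qq powi (- int b))) = neg_lead_sum (- 1) b (Suc k) + neg_sum (- 1) b (Suc k)"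
proof (induction b arbitrary: k)
  case 0
  have "qbinom (qq\<^sup>2) (int 0 + int (Suc i) - 1) (int (Suc i)) = 0" for i
    by (rule qbinom_eq_0) auto
  then have "neg_lead_sum (- 1) 0 (Suc k) = 1"
    unfolding neg_lead_sum_def by (subst sum.lessThan_Suc_shift) simp
  then show ?case
    by (simp add: T_at_minus_one neg_sum_def)
next
  case (Suc b)
  note IH = Suc.IH
  have low: "T_at k (- (qq powi (- int (Suc b)))) = neg_lead_sum (- 1) (Suc b) k + neg_sum (- 1) (Suc b) k"
    for k
  proof (induction k)
    case 0
    then show ?case
      by (simp add: neg_lead_sum_def)
  next
    case (Suc k)
    let ?c = "(- qq) powi (2 * int k + 1 - 2 * int b)" and ?d = "1 - (- 1) * qq powi (- int b)"
    have "T_at (Suc k) (- (qq powi (- int (Suc b))))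
        = ?d * T_at (Suc k) (- (qq powi (- int b))) + ?c * T_at k (- (qq powi (- int (Suc b))))"
      using T_at_qq_negative_step[of "- 1" b k] by simp
    also have "\<dots> = ?d * neg_lead_sum (- 1) b (Suc k) + ?d * neg_sum (- 1) b (Suc k)
        + ?c * (neg_lead_sum (- 1) (Suc b) k + neg_sum (- 1) (Suc b) k)"
      by (simp only: IH Suc.IH distrib_left)
    also have "\<dots> = neg_lead_sum (- 1) (Suc b) (Suc k) + neg_sum (- 1) (Suc b) (Suc k)"
      unfolding neg_sum_Suc neg_lead_sum_Suc by (simp add: distrib_left)
    finally show ?case .
  qed
  show ?case by (rule low)
qed

section \<open>Division by the Pochhammer symbol and the four identities\<close>

lemma qpoch_signed_qq_nonzero:
  assumes "\<epsilon>\<^sup>2 = 1"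
  shows "qpoch (\<epsilon> * qq) qq b \<noteq> 0"
proof -
  have "\<epsilon> * qq ^ Suc l \<noteq> 1" for l
  proof
    assume "\<epsilon> * qq ^ Suc l = 1"
    \<comment> \<open>Squaring removes the sign and leaves a positive power of q^2.\<close>
    then have "(\<epsilon> * qq ^ Suc l)\<^sup>2 = 1"
      by simp
    then show False
      using assms qq_square_power_neq_1[of "Suc l"]
      by (simp only: power_mult_distrib power_mult[symmetric] mult.commute) simp
  qed
  then show ?thesis
    by (auto simp: qpoch_def mult.assoc)
qed

theorem theorem1p3:
  shows "(\<forall>(b::nat) (k::nat). k \<ge> 1 \<longrightarrow>
      T_at k (qq ^ b) =
        (\<Sum>i<k. qq ^ (i * (2 * k + 1)) / qpoch qq qq b * qbinom (qq\<^sup>2) (int b) (int i)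
            * (\<Sum>j = - (int k - int i)..int k - int i. (- qq) powi (j\<^sup>2)))
        + (\<Sum>i<b. qpoch qq qq i / qpoch qq qq b * qq ^ (k * (2 * k + 2 * i + 1))
            * qbinom (qq\<^sup>2) (int b - int i - 1) (int k - 1))
      \<and>
      T_at k (- (qq ^ b)) =
        (\<Sum>i<k. qq ^ (i * (2 * k + 1)) / qpoch (- qq) qq b * qbinom (qq\<^sup>2) (int b) (int i))
        + (\<Sum>i<b. qpoch (- qq) qq i / qpoch (- qq) qq b * qq ^ (k * (2 * k + 2 * i + 1))
            * qbinom (qq\<^sup>2) (int b - int i - 1) (int k - 1)))
    \<and>
    (\<forall>(b::nat) (k::nat). b \<ge> 1 \<longrightarrow>
      T_at k (qq powi (- int b)) =
        (\<Sum>i<b. qpoch (qq powi (1 - int b)) qq i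
            * (- qq) powi (int k * (int k - 2 * int b + 2) + 2 * int i)
            * qbinom (qq\<^sup>2) (int k + int i - 1) (int i))
      \<and>
      T_at k (- (qq powi (- int b))) =
        (\<Sum>i<k. qpoch (- (qq powi (1 - int b))) qq b
            * (- qq) powi (int i * (2 * int k - 2 * int b - int i + 2))
            * qbinom (qq\<^sup>2) (int b + int i - 1) (int i))
        + (- qq) powi ((int k)\<^sup>2 + 2 * int k - 2 * int k * int b)
            * (\<Sum>i<b. qpoch (- (qq powi (1 - int b))) qq i * qq ^ (2 * i)
                * qbinom (qq\<^sup>2) (int k + int i - 1) (int i)))"
proof (intro conjI allI impI)
  fix b k :: nat
  assume "k \<ge> 1"
  then obtain l where k: "k = Suc l"
    by (cases k) auto
  let ?A = "\<lambda>\<epsilon>. \<Sum>i<k. qq ^ (i * (2 * k + 1)) / qpoch (\<epsilon> * qq) qq b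
    * qbinom (qq\<^sup>2) (int b) (int i) * T_at (k - i) \<epsilon>"
  let ?B = "\<lambda>\<epsilon>. \<Sum>i<b. qpoch (\<epsilon> * qq) qq i / qpoch (\<epsilon> * qq) qq b
    * qq ^ (k * (2 * k + 2 * i + 1)) * qbinom (qq\<^sup>2) (int b - int i - 1) (int k - 1)"
  \<comment> \<open>The first two identities differ only in T_(k-i)(\<epsilon>), which is evaluated
    once the sign is chosen.\<close>
  have main: "T_at k (\<epsilon> * qq ^ b) = ?A \<epsilon> + ?B \<epsilon>" if "\<epsilon>\<^sup>2 = 1" for \<epsilon>
  proof -
    have "T_at k (\<epsilon> * qq ^ b)
        = (lead_sum (\<lambda>n. T_at n \<epsilon>) b k + tail_sum (qpoch (\<epsilon> * qq) qq) b k) / qpoch (\<epsilon> * qq) qq b"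
      using T_at_qq_power[OF that, of b l] qpoch_signed_qq_nonzero[OF that, of b] k
      by (simp add: field_simps)
    also have "\<dots> = ?A \<epsilon> + ?B \<epsilon>"
      by (simp add: lead_sum_def tail_sum_def add_divide_distrib sum_divide_distrib)
    finally show ?thesis .
  qed
  have "(\<Sum>j = - (int k - int i)..int k - int i. (- qq) powi (j\<^sup>2)) = T_at (k - i) 1" if "i < k" for i
    using that by (simp add: T_at_one of_nat_diff)
  then show "T_at k (qq ^ b) =
        (\<Sum>i<k. qq ^ (i * (2 * k + 1)) / qpoch qq qq b * qbinom (qq\<^sup>2) (int b) (int i)
            * (\<Sum>j = - (int k - int i)..int k - int i. (- qq) powi (j\<^sup>2)))
        + (\<Sum>i<b. qpoch qq qq i / qpoch qq qq b * qq ^ (k * (2 * k + 2 * i + 1))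
            * qbinom (qq\<^sup>2) (int b - int i - 1) (int k - 1))"
    using main[of 1] by simp
  show "T_at k (- (qq ^ b)) =
        (\<Sum>i<k. qq ^ (i * (2 * k + 1)) / qpoch (- qq) qq b * qbinom (qq\<^sup>2) (int b) (int i))
        + (\<Sum>i<b. qpoch (- qq) qq i / qpoch (- qq) qq b * qq ^ (k * (2 * k + 2 * i + 1))
            * qbinom (qq\<^sup>2) (int b - int i - 1) (int k - 1))"
    using main[of "- 1"] by (simp add: T_at_minus_one)
next
  fix b k :: nat
  assume "b \<ge> 1"
  then obtain c where b: "b = Suc c"
    by (cases b) auto
  have "qq ^ (2 * i) = (- qq) powi (2 * int i)" for i
    by (simp add: power_int_mult power_mult)
  then have "(- qq) powi (int k * (int k - 2 * int b + 2) + 2 * int i)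
      = (- qq) powi (int k * (int k - 2 * int b + 2)) * qq ^ (2 * i)" for i
    by (simp add: power_int_add)
  then show "T_at k (qq powi (- int b)) =
        (\<Sum>i<b. qpoch (qq powi (1 - int b)) qq i
            * (- qq) powi (int k * (int k - 2 * int b + 2) + 2 * int i)
            * qbinom (qq\<^sup>2) (int k + int i - 1) (int i))"
    using T_at_qq_negative_power[of k c]
    by (simp only: b[symmetric] neg_sum_def sum_distrib_left mult_1 mult_ac)
next
  fix b k :: nat
  assume "b \<ge> 1"
  then obtain c where b: "b = Suc c"
    by (cases b) auto
  have "(int k)\<^sup>2 + 2 * int k - 2 * int k * int b = int k * (int k - 2 * int b + 2)"
    by (simp add: algebra_simps power2_eq_square)
  \<comment> \<open>For k = 0 the lead sum is empty and \<open>neg_sum_0\<close> applies, as b \<ge>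
    1.\<close>
  moreover have "T_at k (- (qq powi (- int b))) = neg_lead_sum (- 1) b k + neg_sum (- 1) b k"
    using T_at_minus_qq_negative_power[of "k - 1" b] b by (cases k) (simp_all add: neg_lead_sum_def)
  ultimately show "T_at k (- (qq powi (- int b))) =
        (\<Sum>i<k. qpoch (- (qq powi (1 - int b))) qq b
            * (- qq) powi (int i * (2 * int k - 2 * int b - int i + 2))
            * qbinom (qq\<^sup>2) (int b + int i - 1) (int i))
        + (- qq) powi ((int k)\<^sup>2 + 2 * int k - 2 * int k * int b)
            * (\<Sum>i<b. qpoch (- (qq powi (1 - int b))) qq i * qq ^ (2 * i)
                * qbinom (qq\<^sup>2) (int k + int i - 1) (int i))"
    by (simp add: neg_lead_sum_def neg_sum_def sum_distrib_left mult.assoc)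
qed

end
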